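(* Let $G$ be a connected graph on $n\ge 5$ vertices with chromatic number $\chi\le n-1$, and let $b_\chi=n+\lceil n/\chi\rceil$. Then the following hold. (a) $\mu_G([0,b_\chi))\le n-\lceil n/\chi\rceil+1$; equivalently, $\mu_G([b_\chi,\partial_1^L(G)])\ge \lceil n/\chi\rceil-1$. (b) If $\operatorname{diam}(G)\ge 3$, then $$\mu_G([0,b_\chi))\le n-\max\left\{2,\left\lceil\frac{n}{\chi}\right\rceil-1\right\};$$ equivalently, $$\mu_G([b_\chi,\partial_1^L(G)])\ge\max\left\{2,\left\lceil\frac{n}{\chi}\right\rceil-1\right\}.$$
   Context: Graphs are finite, simple and undirected. For a connected graph $G$ with vertices $v_1,\dots,v_n$, let $d_G(u,v)$ be the length of a shortest $u$–$v$ path, $\operatorname{diam}(G)=\max_{u,v}d_G(u,v)$, $D(G)=(d_G(v_i,v_j))_{i,j}$ the distance matrix, and $\operatorname{Tr}_G(v)=\sum_{u\in V(G)}d_G(u,v)$ the transmission of $v$. The distance Laplacian matrix is $\mathcal{D}^{L}(G)=\operatorname{diag}(\operatorname{Tr}_G(v_1),\dots,\operatorname{Tr}_G(v_n))-D(G)$, a real symmetric positive semidefinite matrix with $\mathcal{D}^{L}(G)\mathbf 1=\mathbf 0$. Its eigenvalues, listed with multiplicity, are ordered $\partial^{L}_1(G)\ge\partial^{L}_2(G)\ge\cdots\ge\partial^{L}_n(G)=0$. For a real interval $I$, $\mu_G(I)$ is the number of eigenvalues of $\mathcal{D}^{L}(G)$ in $I$, counted with multiplicity. *)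

theory Defs
  imports
    "Graph_Theory.Graph_Theory"
    "Jordan_Normal_Form.Char_Poly"
begin

text \<open>
  A finite simple undirected graph is a digraph satisfying the locale predicate
  \<open>graph\<close> of the entry Graph_Theory: finite, loop-free, without parallel arcs and
  with a symmetric adjacency relation, so that every edge is represented by two
  opposite arcs.
\<close>

definition graph_dist :: "('a, 'b) pre_digraph \<Rightarrow> 'a \<Rightarrow> 'a \<Rightarrow> nat" where
  "graph_dist G u v = (LEAST k. \<exists>p. pre_digraph.apath G u p v \<and> length p = k)"

definition graph_diam :: "('a, 'b) pre_digraph \<Rightarrow> nat" where
  "graph_diam G = Max {graph_dist G u v | u v. u \<in> verts G \<and> v \<in> verts G}"

definition transmission :: "('a, 'b) pre_digraph \<Rightarrow> 'a \<Rightarrow> nat" where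
  "transmission G v = (\<Sum>u\<in>verts G. graph_dist G u v)"

definition proper_coloring :: "('a, 'b) pre_digraph \<Rightarrow> nat \<Rightarrow> ('a \<Rightarrow> nat) \<Rightarrow> bool" where
  "proper_coloring G k c \<longleftrightarrow>
     (\<forall>v\<in>verts G. c v < k) \<and> (\<forall>u v. u \<rightarrow>\<^bsub>G\<^esub> v \<longrightarrow> c u \<noteq> c v)"

definition chromatic_number :: "('a, 'b) pre_digraph \<Rightarrow> nat" where
  "chromatic_number G = (LEAST k. \<exists>c. proper_coloring G k c)"

text \<open>
  Matrices are taken with respect to a listing \<open>vs\<close> of the vertices without repetition;
  the entry in row \<open>i\<close> and column \<open>j\<close> belongs to the vertices \<open>vs ! i\<close> and \<open>vs ! j\<close>.
\<close>

definition distance_matrix :: "('a, 'b) pre_digraph \<Rightarrow> 'a list \<Rightarrow> real mat" where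
  "distance_matrix G vs =
     mat (length vs) (length vs) (\<lambda>(i, j). real (graph_dist G (vs ! i) (vs ! j)))"

definition distance_laplacian :: "('a, 'b) pre_digraph \<Rightarrow> 'a list \<Rightarrow> real mat" where
  "distance_laplacian G vs =
     mat_diag (length vs) (\<lambda>i. real (transmission G (vs ! i))) - distance_matrix G vs"

definition eigenvalues_mset :: "real mat \<Rightarrow> real multiset" where
  "eigenvalues_mset A = proots (char_poly A)"

text \<open>The eigenvalues are numbered from 1, in non-increasing order.\<close>

definition dL_eigenvalue :: "('a, 'b) pre_digraph \<Rightarrow> 'a list \<Rightarrow> nat \<Rightarrow> real" where
  "dL_eigenvalue G vs i =
     rev (sorted_list_of_multiset (eigenvalues_mset (distance_laplacian G vs))) ! (i - 1)"

definition dL_count :: "('a, 'b) pre_digraph \<Rightarrow> 'a list \<Rightarrow> real set \<Rightarrow> nat" where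
  "dL_count G vs I =
     size (filter_mset (\<lambda>x. x \<in> I) (eigenvalues_mset (distance_laplacian G vs)))"

end

theory Submission
  imports Defs
begin

text \<open>
  The quadratic form of the distance Laplacian sends \<open>x\<close> to the sum of
  \<open>d(u,v) (x u - x v)\<^sup>2\<close> over the unordered pairs of vertices. If all distances were 1, it would be
  \<open>n (x \<bullet> x)\<close> on vectors of sum zero; the excess distances \<open>d - 1\<close> only add to this. By the
  Courant-Fischer principle (\<open>eigenvalue_count_by_constraints\<close>), which rests on the spectral theorem
  (\<open>real_symmetric_orthogonally_diagonalizable\<close>), a \<open>k\<close>-dimensional subspace on which the form is at
  least \<open>b (x \<bullet> x)\<close> yields \<open>k\<close> eigenvalues at least \<open>b\<close>. Since the matrix has \<open>n\<close>
  eigenvalues in all, this also bounds the number of those below \<open>b\<close>.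

  For the first part the subspace lives on a largest colour class \<open>C\<close> of an optimal colouring, which
  has \<open>card C \<ge> \<lceil>n / \<chi>\<rceil>\<close> (\<open>large_independent_set\<close>). Inside \<open>C\<close> all distances are at least 2, so
  the vectors of sum zero supported on \<open>C\<close> gain another \<open>card C\<close>
  (\<open>eigenvalue_count_independent_set\<close>).

  For the second part only \<open>\<lceil>n / \<chi>\<rceil> = 2\<close> is new, and two eigenvalues at least \<open>n + 2\<close> are
  wanted. Two vertices at distance at least 3, with one neighbour of each, span a weighted path of
  excess distances on four vertices whose Laplacian is at least 2 on a suitable plane
  (\<open>eigenvalue_count_diameter_3\<close>).
\<close>

section \<open>Orthogonal diagonalization of real symmetric matrices\<close>

lemma symmetric_bilinear:
  fixes A :: "'a :: comm_semiring_0 mat"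
  assumes A: "A \<in> carrier_mat n n" and sym: "transpose_mat A = A"
    and x: "x \<in> carrier_vec n" and y: "y \<in> carrier_vec n"
  shows "x \<bullet> (A *\<^sub>v y) = (A *\<^sub>v x) \<bullet> y"
proof -
  have "x \<bullet> (A *\<^sub>v y) = (transpose_mat A *\<^sub>v x) \<bullet> y"
    using transpose_vec_mult_scalar[OF A y x] by simp
  thus ?thesis unfolding sym .
qed

lemma scalar_prod_self_pos:
  fixes x :: "real vec"
  assumes "x \<in> carrier_vec n" "x \<noteq> 0\<^sub>v n"
  shows "x \<bullet> x > 0"
  using conjugate_square_greater_0_vec[OF assms(1)] assms by simp

text \<open>
  Over the complex numbers the characteristic polynomial has a root \<open>c\<close>. Splitting an
  eigenvector into real and imaginary parts \<open>x\<close>, \<open>y\<close> and comparing \<open>x \<bullet> A y\<close> with \<open>A x \<bullet> y\<close>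
  gives \<open>Im c (x \<bullet> x + y \<bullet> y) = 0\<close>. So \<open>c\<close> is real, and whichever of \<open>x\<close>, \<open>y\<close> is nonzero
  is a real eigenvector.
\<close>

lemma real_symmetric_eigenvector:
  fixes A :: "real mat"
  assumes A: "A \<in> carrier_mat n n" and sym: "transpose_mat A = A" and n: "n > 0"
  obtains a v where "eigenvector A v a"
proof -
  let ?B = "map_mat complex_of_real A"
  have B: "?B \<in> carrier_mat n n" using A by simp
  have "degree (char_poly ?B) \<noteq> 0" using degree_monic_char_poly[OF B] n by simp
  then obtain c where "poly (char_poly ?B) c = 0"
    using fundamental_theorem_of_algebra[of "char_poly ?B"] by (auto simp: constant_degree)
  hence "eigenvalue ?B c" using eigenvalue_root_char_poly[OF B] by simp
  then obtain z where z: "z \<in> carrier_vec n" "z \<noteq> 0\<^sub>v n" and ev: "?B *\<^sub>v z = c \<cdot>\<^sub>v z"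
    using B unfolding eigenvalue_def eigenvector_def by auto
  define x where "x = map_vec Re z"
  define y where "y = map_vec Im z"
  have x: "x \<in> carrier_vec n" and y: "y \<in> carrier_vec n" using z by (auto simp: x_def y_def)
  have Ax: "A *\<^sub>v x = Re c \<cdot>\<^sub>v x - Im c \<cdot>\<^sub>v y"
  proof (rule eq_vecI)
    fix i assume "i < dim_vec (Re c \<cdot>\<^sub>v x - Im c \<cdot>\<^sub>v y)"
    hence i: "i < n" using x y by simp
    have "(A *\<^sub>v x) $ i = Re ((?B *\<^sub>v z) $ i)"
      using i A z by (simp add: scalar_prod_def x_def)
    thus "(A *\<^sub>v x) $ i = (Re c \<cdot>\<^sub>v x - Im c \<cdot>\<^sub>v y) $ i"
      using i z unfolding ev by (simp add: x_def y_def)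
  qed (use A y in auto)
  have Ay: "A *\<^sub>v y = Im c \<cdot>\<^sub>v x + Re c \<cdot>\<^sub>v y"
  proof (rule eq_vecI)
    fix i assume "i < dim_vec (Im c \<cdot>\<^sub>v x + Re c \<cdot>\<^sub>v y)"
    hence i: "i < n" using x y by simp
    have "(A *\<^sub>v y) $ i = Im ((?B *\<^sub>v z) $ i)"
      using i A z by (simp add: scalar_prod_def y_def)
    thus "(A *\<^sub>v y) $ i = (Im c \<cdot>\<^sub>v x + Re c \<cdot>\<^sub>v y) $ i"
      using i z unfolding ev by (simp add: x_def y_def algebra_simps)
  qed (use A y in auto)
  have xy: "y \<bullet> x = x \<bullet> y" by (rule comm_scalar_prod[OF y x])
  have "x \<bullet> (A *\<^sub>v y) = Im c * (x \<bullet> x) + Re c * (x \<bullet> y)"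
    unfolding Ay using x y by (simp add: scalar_prod_add_distrib[of _ n])
  moreover have "(A *\<^sub>v x) \<bullet> y = Re c * (x \<bullet> y) - Im c * (y \<bullet> y)"
    unfolding Ax using x y by (simp add: minus_scalar_prod_distrib[of _ n])
  ultimately have 0: "Im c * (x \<bullet> x + y \<bullet> y) = 0"
    using symmetric_bilinear[OF A sym x y] by (simp add: algebra_simps)
  have nz: "x \<noteq> 0\<^sub>v n \<or> y \<noteq> 0\<^sub>v n"
  proof (rule ccontr)
    assume "\<not> ?thesis"
    hence e: "x = 0\<^sub>v n" "y = 0\<^sub>v n" by auto
    have "z = 0\<^sub>v n"
    proof (rule eq_vecI)
      fix i assume "i < dim_vec (0\<^sub>v n :: complex vec)"
      hence i: "i < n" by simp
      have "Re (z $ i) = x $ i" "Im (z $ i) = y $ i" using i z by (auto simp: x_def y_def)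
      thus "z $ i = 0\<^sub>v n $ i" using i e by (simp add: complex_eq_iff)
    qed (use z in auto)
    thus False using z by simp
  qed
  hence "x \<bullet> x + y \<bullet> y > 0"
    using scalar_prod_self_pos[OF x] scalar_prod_self_pos[OF y]
      conjugate_square_ge_0_vec[of x] conjugate_square_ge_0_vec[of y]
    by (auto intro: add_nonneg_pos add_pos_nonneg)
  hence "Im c = 0" using 0 by simp
  hence "A *\<^sub>v x = Re c \<cdot>\<^sub>v x" "A *\<^sub>v y = Re c \<cdot>\<^sub>v y" using x y Ax Ay by auto
  hence "eigenvector A x (Re c) \<or> eigenvector A y (Re c)"
    using nz x y A unfolding eigenvector_def by auto
  thus ?thesis using that by blast
qed

text \<open>
  The Householder reflection that exchanges the first unit vector and \<open>v\<close>. It is preferred to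
  completing \<open>v\<close> to an orthonormal basis because it is its own inverse and its own transpose.
\<close>

lemma orthogonal_matrix_with_first_column:
  fixes v :: "real vec"
  assumes v: "v \<in> carrier_vec n" and unit: "v \<bullet> v = 1" and n: "n > 0"
  obtains H where "H \<in> carrier_mat n n" "transpose_mat H = H" "H * H = 1\<^sub>m n" "col H 0 = v"
proof (cases "v $ 0 = 1")
  case True
  have "v \<bullet> v = v $ 0 * v $ 0 + (\<Sum>i\<in>{0..<n}-{0}. v $ i * v $ i)"
    using v n by (simp add: scalar_prod_def sum.remove[of _ 0])
  hence "(\<Sum>i\<in>{0..<n}-{0}. v $ i * v $ i) = 0" using unit True by simp
  hence "\<forall>i\<in>{0..<n}-{0}. v $ i * v $ i = 0"
    by (subst (asm) sum_nonneg_eq_0_iff) auto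
  hence "v = col (1\<^sub>m n) 0" using v n True by (intro eq_vecI) auto
  thus ?thesis using that[of "1\<^sub>m n"] by simp
next
  case False
  define w where "w = (\<lambda>i. (if i = 0 then 1 else 0) - v $ i)"
  \<comment> \<open>The reflection is \<open>1 - 2 w w\<^sup>T / (w \<bullet> w)\<close> with \<open>w\<close> the difference of the two
    vectors; \<open>c\<close> is the factor \<open>2 / (w \<bullet> w)\<close>, evaluated with \<open>v \<bullet> v = 1\<close>.\<close>
  define c where "c = 1 / (1 - v $ 0)"
  define H where "H = mat n n (\<lambda>(i,j). (if i = j then 1 else 0) - c * w i * w j)"
  have H: "H \<in> carrier_mat n n" by (simp add: H_def)
  have "(\<Sum>i<n. w i * w i) = (\<Sum>i<n. (if i = 0 then 1 - 2 * v $ 0 else 0) + v $ i * v $ i)"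
    by (intro sum.cong) (auto simp: w_def algebra_simps)
  also have "\<dots> = 2 * (1 - v $ 0)"
    using unit v n by (simp add: sum.distrib scalar_prod_def lessThan_atLeast0)
  finally have ww: "(\<Sum>i<n. w i * w i) = 2 * (1 - v $ 0)" .
  have cww: "c * (\<Sum>i<n. w i * w i) = 2" using False by (simp add: c_def ww divide_simps)
  have "H * H = 1\<^sub>m n"
  proof (rule eq_matI)
    fix i j assume "i < dim_row (1\<^sub>m n)" "j < dim_col (1\<^sub>m n)"
    hence ij: "i < n" "j < n" by auto
    have "(H * H) $$ (i,j) = (\<Sum>k<n. H $$ (i,k) * H $$ (k,j))"
      using ij H by (simp add: scalar_prod_def lessThan_atLeast0)
    also have "\<dots> = (\<Sum>k<n. (if k = i then (if i = j then 1 else 0) - c * w i * w j else 0)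
          - (if k = j then c * w i * w j else 0) + c * w i * w j * c * (w k * w k))"
      using ij by (intro sum.cong) (auto simp: H_def algebra_simps)
    also have "\<dots> = (if i = j then 1 else 0) - 2 * (c * w i * w j) + c * w i * w j * (c * (\<Sum>k<n. w k * w k))"
      using ij by (simp add: sum.distrib sum_subtractf sum_distrib_left mult.assoc)
    also have "\<dots> = (if i = j then 1 else 0)" unfolding cww by simp
    finally show "(H * H) $$ (i,j) = 1\<^sub>m n $$ (i,j)" using ij by simp
  qed (use H in auto)
  moreover have "transpose_mat H = H" by (rule eq_matI) (auto simp: H_def)
  moreover have "col H 0 = v"
    using n v False by (intro eq_vecI) (auto simp: H_def w_def c_def field_simps)
  ultimately show ?thesis using that[OF H] by blast
qed

text \<open>
  Spectral theorem, by deflation: after conjugation with an orthogonal matrix whose first column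
  is a unit eigenvector, the first column is a multiple of the first unit vector, by symmetry so is
  the first row, and the induction hypothesis applies to the remaining symmetric block.
\<close>

lemma real_symmetric_orthogonally_diagonalizable:
  fixes A :: "real mat"
  assumes "A \<in> carrier_mat n n" and "transpose_mat A = A"
  shows "\<exists>U f. similar_mat_wit A (mat_diag n f) U (transpose_mat U)"
  using assms
proof (induction n arbitrary: A)
  case 0
  have "A = mat_diag 0 (\<lambda>_. 0)" using 0 by (intro eq_matI) (auto simp: mat_diag_def)
  hence "similar_mat_wit A (mat_diag 0 (\<lambda>_. 0)) (1\<^sub>m 0) (1\<^sub>m 0)"
    using similar_mat_wit_refl[OF 0(1)] by simp
  thus ?case by (metis transpose_one)
next
  case (Suc n)
  note A = Suc.prems(1) and sym = Suc.prems(2)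
  obtain a v0 where "eigenvector A v0 a"
    using real_symmetric_eigenvector[OF A sym zero_less_Suc] by blast
  hence v0: "v0 \<in> carrier_vec (Suc n)" "v0 \<noteq> 0\<^sub>v (Suc n)" "A *\<^sub>v v0 = a \<cdot>\<^sub>v v0"
    using A by (auto simp: eigenvector_def)
  define v where "v = (1 / sqrt (v0 \<bullet> v0)) \<cdot>\<^sub>v v0"
  have v: "v \<in> carrier_vec (Suc n)" using v0 by (simp add: v_def)
  have "v0 \<bullet> v0 > 0" by (rule scalar_prod_self_pos[OF v0(1,2)])
  hence vv: "v \<bullet> v = 1" using v0(1) by (simp add: v_def)
  have Av: "A *\<^sub>v v = a \<cdot>\<^sub>v v"
    using v0 A by (simp add: v_def mult_mat_vec smult_smult_assoc mult.commute)
  obtain H where H: "H \<in> carrier_mat (Suc n) (Suc n)" "transpose_mat H = H"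
      "H * H = 1\<^sub>m (Suc n)" "col H 0 = v"
    using orthogonal_matrix_with_first_column[OF v vv] by auto
  define B where "B = H * A * H"
  have B: "B \<in> carrier_mat (Suc n) (Suc n)" using H A by (simp add: B_def)
  have symB: "transpose_mat B = B"
    unfolding B_def using H A sym
    by (simp add: transpose_mult[of _ "Suc n" "Suc n" _ "Suc n"] assoc_mult_mat[of _ "Suc n" "Suc n" _ "Suc n" _ "Suc n"])
  have "H * B * H = (H * H) * A * (H * H)"
    using H(1) A unfolding B_def by (simp add: assoc_mult_mat[of _ "Suc n" "Suc n" _ "Suc n" _ "Suc n"])
  hence HBH: "A = H * B * H" using H A by simp
  have simB: "similar_mat_wit A B H H"
    by (rule similar_mat_witI[OF H(3) H(3) HBH A B H(1) H(1)])
  have Hv: "H *\<^sub>v v = unit_vec (Suc n) 0"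
  proof -
    have "H *\<^sub>v v = col (H * H) 0" using H by (metis col_mult2 zero_less_Suc)
    thus ?thesis using H(3) by simp
  qed
  have "col B 0 = H *\<^sub>v (A *\<^sub>v v)"
  proof -
    have "col B 0 = col (H * (A * H)) 0"
      using H A unfolding B_def by (simp add: assoc_mult_mat[of _ "Suc n" "Suc n" _ "Suc n" _ "Suc n"])
    also have "\<dots> = H *\<^sub>v col (A * H) 0"
      using H A by (intro col_mult2) auto
    also have "col (A * H) 0 = A *\<^sub>v v"
      unfolding H(4)[symmetric] using H A by (intro col_mult2) auto
    finally show ?thesis .
  qed
  hence colB: "col B 0 = a \<cdot>\<^sub>v unit_vec (Suc n) 0"
    unfolding Av using H v by (simp add: mult_mat_vec[of _ "Suc n" "Suc n"] Hv)
  have B0: "B $$ (i, 0) = (if i = 0 then a else 0)" if "i < Suc n" for i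
    using arg_cong[OF colB, of "\<lambda>x. x $ i"] that B by simp
  have B0': "B $$ (0, i) = (if i = 0 then a else 0)" if "i < Suc n" for i
    using B0[OF that] arg_cong[OF symB, of "\<lambda>M. M $$ (i,0)"] that B by simp
  define C where "C = mat n n (\<lambda>(i,j). B $$ (Suc i, Suc j))"
  have C: "C \<in> carrier_mat n n" by (simp add: C_def)
  have BC: "B = four_block_mat (mat 1 1 (\<lambda>_. a)) (0\<^sub>m 1 n) (0\<^sub>m n 1) C"
    using B B0 B0' by (intro eq_matI) (auto simp: C_def)
  have symC: "transpose_mat C = C"
  proof (rule eq_matI)
    fix i j assume "i < dim_row C" "j < dim_col C"
    thus "transpose_mat C $$ (i,j) = C $$ (i,j)"
      using arg_cong[OF symB, of "\<lambda>M. M $$ (Suc i,Suc j)"] B by (simp add: C_def)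
  qed (simp_all add: C_def)
  obtain V g where V: "similar_mat_wit C (mat_diag n g) V (transpose_mat V)"
    using Suc.IH[OF C symC] by blast
  have Vc: "V \<in> carrier_mat n n" using similar_mat_witD2(6)[OF C V] .
  define W where "W = four_block_mat (1\<^sub>m 1) (0\<^sub>m 1 n) (0\<^sub>m n 1) V"
  define f where "f = (\<lambda>i. case i of 0 \<Rightarrow> a | Suc j \<Rightarrow> g j)"
  have W: "W \<in> carrier_mat (Suc n) (Suc n)" using Vc unfolding W_def by auto
  have Wt: "transpose_mat W = four_block_mat (1\<^sub>m 1) (0\<^sub>m 1 n) (0\<^sub>m n 1) (transpose_mat V)"
    unfolding W_def using Vc by (subst transpose_four_block_mat[of _ 1 1 _ n _ n]) auto
  have D: "mat_diag (Suc n) f = four_block_mat (mat 1 1 (\<lambda>_. a)) (0\<^sub>m 1 n) (0\<^sub>m n 1) (mat_diag n g)"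
    by (rule eq_matI) (auto simp: mat_diag_def f_def split: nat.splits)
  have "similar_mat_wit (mat 1 1 (\<lambda>_. a)) (mat 1 1 (\<lambda>_. a)) (1\<^sub>m 1) (1\<^sub>m 1)"
    by (rule similar_mat_wit_refl[of _ 1]) simp
  hence "similar_mat_wit B (mat_diag (Suc n) f) W (transpose_mat W)"
    unfolding BC W_def[symmetric] Wt D unfolding W_def
    by (rule similar_mat_wit_four_block[OF _ V, of _ _ _ _ _ _ _ _ 1 n]) (use Vc C in auto)
  from similar_mat_wit_trans[OF simB this]
  have "similar_mat_wit A (mat_diag (Suc n) f) (H * W) (transpose_mat (H * W))"
    using H W by (simp add: transpose_mult[of _ "Suc n" "Suc n" _ "Suc n"])
  thus ?case by blast
qed

lemma eigenvalues_mset_similar_diagonal: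
  assumes A: "A \<in> carrier_mat n n" and "similar_mat_wit A (mat_diag n f) P Q"
  shows "eigenvalues_mset A = image_mset f (mset_set {..<n})"
proof -
  have "char_poly A = char_poly (mat_diag n f)"
    using assms by (intro char_poly_similar) (auto simp: similar_mat_def)
  also have "\<dots> = (\<Prod>a \<leftarrow> diag_mat (mat_diag n f). [:- a, 1:])"
    by (rule char_poly_upper_triangular[OF mat_diag_dim]) (auto simp: upper_triangular_def mat_diag_def)
  also have "diag_mat (mat_diag n f) = map f [0..<n]"
    by (intro nth_equalityI) (auto simp: diag_mat_def mat_diag_def)
  also have "(\<Prod>a \<leftarrow> map f [0..<n]. [:- a, 1:]) = (\<Prod>i<n. [:- f i, 1:])"
    by (simp add: prod.distinct_set_conv_list[symmetric] lessThan_atLeast0 o_def)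
  finally have "eigenvalues_mset A = (\<Sum>i<n. {#f i#})"
    unfolding eigenvalues_mset_def by (simp add: proots_prod)
  thus ?thesis by (simp add: sum_unfold_sum_mset image_mset.compositionality o_def)
qed

lemma size_eigenvalues_mset_symmetric:
  fixes A :: "real mat"
  assumes A: "A \<in> carrier_mat n n" and sym: "transpose_mat A = A"
  shows "size (eigenvalues_mset A) = n"
proof -
  obtain U f where "similar_mat_wit A (mat_diag n f) U (transpose_mat U)"
    using real_symmetric_orthogonally_diagonalizable[OF A sym] by blast
  from eigenvalues_mset_similar_diagonal[OF A this] show ?thesis by simp
qed

section \<open>Counting eigenvalues by linear constraints\<close>

text \<open>
  Padding the system with zero equations makes it square and singular.
\<close>

lemma underdetermined_homogeneous_system:
  fixes R :: "'a :: idom vec list"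
  assumes R: "set R \<subseteq> carrier_vec n" and len: "length R < n"
  obtains x where "x \<in> carrier_vec n" "x \<noteq> 0\<^sub>v n" "\<forall>\<rho>\<in>set R. \<rho> \<bullet> x = 0"
proof -
  define M where "M = mat_of_rows n (R @ replicate (n - length R) (0\<^sub>v n))"
  have M: "M \<in> carrier_mat n n" using len by (intro carrier_matI) (simp_all add: M_def)
  \<comment> \<open>The last row is one of the padding rows, so the transpose kills the last unit vector.\<close>
  have "transpose_mat M *\<^sub>v unit_vec n (n - 1) = 0\<^sub>v n"
    using len M
    by (intro eq_vecI) (auto simp: M_def mat_of_rows_def nth_append scalar_prod_right_unit)
  moreover have "unit_vec n (n - 1) \<noteq> (0\<^sub>v n :: 'a vec)" using len by simp
  ultimately have "det (transpose_mat M) = 0"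
    using det_0_iff_vec_prod_zero[of "transpose_mat M" n] M
    by (metis transpose_carrier_mat unit_vec_carrier)
  hence "det M = 0" using det_transpose[OF M] by simp
  then obtain x where x: "x \<in> carrier_vec n" "x \<noteq> 0\<^sub>v n" "M *\<^sub>v x = 0\<^sub>v n"
    using det_0_iff_vec_prod_zero[OF M] by blast
  have "\<rho> \<bullet> x = 0" if \<rho>: "\<rho> \<in> set R" for \<rho>
  proof -
    obtain i where i: "i < length R" "\<rho> = R ! i" using \<rho> by (auto simp: in_set_conv_nth)
    hence "row M i = \<rho>" using len R unfolding M_def
      by (subst mat_of_rows_row) (auto simp: nth_append)
    thus ?thesis using arg_cong[OF x(3), of "\<lambda>y. y $ i"] i len M by simp
  qed
  thus ?thesis using that x by blast
qed

text \<open>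
  One half of the Courant-Fischer principle, with the test subspace given by the equations that cut
  it out. If fewer eigenvalues than claimed were at least \<open>b\<close>, then the constraints together with
  orthogonality to the eigenvectors of those eigenvalues would be fewer than \<open>n\<close> equations. A nonzero common
  solution is a combination of eigenvectors with eigenvalues below \<open>b\<close>, so the form is below
  \<open>b (x \<bullet> x)\<close> on it, a contradiction.
\<close>

lemma eigenvalue_count_by_constraints:
  fixes A :: "real mat"
  assumes A: "A \<in> carrier_mat n n" and sym: "transpose_mat A = A"
    and R: "set R \<subseteq> carrier_vec n"
    and form: "\<And>x. x \<in> carrier_vec n \<Longrightarrow> \<forall>\<rho>\<in>set R. \<rho> \<bullet> x = 0 \<Longrightarrow> x \<bullet> (A *\<^sub>v x) \<ge> b * (x \<bullet> x)"
  shows "n \<le> length R + size (filter_mset (\<lambda>e. e \<ge> b) (eigenvalues_mset A))"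
proof (rule ccontr)
  obtain U f where U: "similar_mat_wit A (mat_diag n f) U (transpose_mat U)"
    using real_symmetric_orthogonally_diagonalizable[OF A sym] by blast
  note Ud = similar_mat_witD2[OF A U]
  define L where "L = filter (\<lambda>i. f i \<ge> b) [0..<n]"
  have "size (filter_mset (\<lambda>e. e \<ge> b) (eigenvalues_mset A)) = length L"
    unfolding eigenvalues_mset_similar_diagonal[OF A U] L_def
    by (simp add: filter_mset_image_mset distinct_length_filter Int_def conj_commute)
  moreover assume "\<not> n \<le> length R + size (filter_mset (\<lambda>e. e \<ge> b) (eigenvalues_mset A))"
  ultimately have "length (R @ map (col U) L) < n" by simp
  moreover have "set (R @ map (col U) L) \<subseteq> carrier_vec n" using R Ud(6) by (auto simp: col_dim)
  ultimately obtain x where x: "x \<in> carrier_vec n" "x \<noteq> 0\<^sub>v n"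
      and Rx: "\<forall>\<rho>\<in>set (R @ map (col U) L). \<rho> \<bullet> x = 0"
    using underdetermined_homogeneous_system by metis
  \<comment> \<open>Coordinates of \<open>x\<close> in the orthonormal eigenbasis.\<close>
  define y where "y = transpose_mat U *\<^sub>v x"
  have y: "y \<in> carrier_vec n" using Ud x by (simp add: y_def)
  have xy: "x = U *\<^sub>v y"
    unfolding y_def using Ud x by (simp add: assoc_mult_mat_vec[symmetric])
  have yL: "y $ i = 0" if "i < n" "f i \<ge> b" for i
  proof -
    have "y $ i = col U i \<bullet> x" using that Ud(6) by (simp add: y_def)
    also have "\<dots> = 0" using Rx that by (auto simp: L_def)
    finally show ?thesis .
  qed
  have "y \<noteq> 0\<^sub>v n"
  proof
    assume "y = 0\<^sub>v n"
    hence "x = 0\<^sub>v n" using Ud(6) unfolding xy by (intro eq_vecI) auto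
    thus False using x by simp
  qed
  then obtain k where k: "k < n" "y $ k \<noteq> 0" using y by (metis carrier_vecD eq_vecI index_zero_vec)
  have Dy: "mat_diag n f *\<^sub>v y \<in> carrier_vec n"
    by (rule mult_mat_vec_carrier[OF mat_diag_dim y])
  have "A *\<^sub>v x = U *\<^sub>v (mat_diag n f *\<^sub>v y)"
    unfolding y_def using Ud x by (subst Ud(3)) (simp add: assoc_mult_mat_vec[of _ n n _ n])
  hence "x \<bullet> (A *\<^sub>v x) = y \<bullet> (mat_diag n f *\<^sub>v y)"
    using transpose_vec_mult_scalar[OF Ud(6) Dy x(1)] by (simp add: y_def)
  also have "mat_diag n f *\<^sub>v y = vec n (\<lambda>i. f i * y $ i)"
    using y by (intro eq_vecI) (auto simp: mat_diag_def scalar_prod_def if_distrib[of "\<lambda>x. x * _"] sum.delta cong: if_cong)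
  also have "y \<bullet> vec n (\<lambda>i. f i * y $ i) = (\<Sum>i<n. f i * (y $ i)\<^sup>2)"
    by (simp add: scalar_prod_def lessThan_atLeast0 power2_eq_square ac_simps)
  finally have form_y: "x \<bullet> (A *\<^sub>v x) = (\<Sum>i<n. f i * (y $ i)\<^sup>2)" .
  have "x \<bullet> x = x \<bullet> (U *\<^sub>v y)" using xy by simp
  also have "\<dots> = y \<bullet> y" using transpose_vec_mult_scalar[OF Ud(6) y x(1)] by (simp add: y_def)
  also have "\<dots> = (\<Sum>i<n. (y $ i)\<^sup>2)"
    using y by (simp add: scalar_prod_def lessThan_atLeast0 power2_eq_square)
  finally have norm_y: "x \<bullet> x = (\<Sum>i<n. (y $ i)\<^sup>2)" .
  have "(\<Sum>i<n. f i * (y $ i)\<^sup>2) < (\<Sum>i<n. b * (y $ i)\<^sup>2)"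
  proof (rule sum_strict_mono_ex1)
    show "\<forall>i\<in>{..<n}. f i * (y $ i)\<^sup>2 \<le> b * (y $ i)\<^sup>2"
      using yL by (metis lessThan_iff linorder_le_cases mult_right_mono power_zero_numeral mult_zero_right order_refl zero_le_power2)
    show "\<exists>i\<in>{..<n}. f i * (y $ i)\<^sup>2 < b * (y $ i)\<^sup>2"
      using k yL[of k] by (intro bexI[of _ k]) (auto simp: not_le[symmetric])
  qed simp
  hence "x \<bullet> (A *\<^sub>v x) < b * (x \<bullet> x)"
    unfolding form_y norm_y by (simp add: sum_distrib_left)
  moreover have "x \<bullet> (A *\<^sub>v x) \<ge> b * (x \<bullet> x)" using form[OF x(1)] Rx by simp
  ultimately show False by simp
qed

lemma eigenvalue_le_dL_eigenvalue_1:
  assumes "e \<in># eigenvalues_mset (distance_laplacian G vs)"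
  shows "e \<le> dL_eigenvalue G vs 1"
proof -
  let ?xs = "sorted_list_of_multiset (eigenvalues_mset (distance_laplacian G vs))"
  have e: "e \<in> set ?xs" using assms by simp
  hence "?xs \<noteq> []" by (cases ?xs) simp_all
  hence "dL_eigenvalue G vs 1 = last ?xs"
    unfolding dL_eigenvalue_def by (simp add: hd_conv_nth[symmetric] hd_rev del: set_sorted_list_of_multiset)
  moreover obtain i where i: "i < length ?xs" "?xs ! i = e" using e by (auto simp only: in_set_conv_nth)
  have "?xs ! i \<le> ?xs ! (length ?xs - 1)"
    using i(1) by (intro sorted_nth_mono sorted_sorted_list_of_multiset) auto
  ultimately show ?thesis using i \<open>?xs \<noteq> []\<close> by (simp add: last_conv_nth)
qed

text \<open>
  The right end point is the largest eigenvalue, so it cuts nothing off.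
\<close>

lemma dL_count_from_below:
  "dL_count G vs {b..dL_eigenvalue G vs 1}
    = size (filter_mset (\<lambda>e. e \<ge> b) (eigenvalues_mset (distance_laplacian G vs)))"
  unfolding dL_count_def
  by (intro arg_cong[of _ _ size] filter_mset_cong refl)
    (auto intro: eigenvalue_le_dL_eigenvalue_1[unfolded One_nat_def])

lemma dL_count_disjoint:
  "dL_count G vs {a..<b} + size (filter_mset (\<lambda>e. e \<ge> b) (eigenvalues_mset (distance_laplacian G vs)))
    \<le> size (eigenvalues_mset (distance_laplacian G vs))"
proof -
  let ?M = "eigenvalues_mset (distance_laplacian G vs)"
  have "size (filter_mset (\<lambda>e. e \<in> {a..<b}) ?M) \<le> size (filter_mset (\<lambda>e. \<not> e \<ge> b) ?M)"
    by (intro size_mset_mono filter_mset_mono_strong) auto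
  moreover have "size ?M = size (filter_mset (\<lambda>e. e \<ge> b) ?M) + size (filter_mset (\<lambda>e. \<not> e \<ge> b) ?M)"
    by (metis multiset_partition size_union)
  ultimately show ?thesis by (simp add: dL_count_def)
qed

section \<open>Distances in a graph\<close>

lemma (in wf_digraph) length_awalk_to_apath_le:
  assumes "awalk u p v"
  shows "length (awalk_to_apath p) \<le> length p"
  using assms
proof (induct rule: awalk_to_apath_induct)
  case (path p)
  then have "awalk_to_apath p = p" by (auto simp: awalk_to_apath.simps)
  then show ?case by simp
next
  case (decomp p q r s)
  then have "awalk_to_apath p = awalk_to_apath (q @ s)"
    using step_awalk_to_apath[of _ p _ q r s] by simp
  moreover have "length (q @ s) \<le> length p"
    using decomp by (auto elim!: awalk_cyc_decompE)
  ultimately show ?case using decomp by simp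
qed

text \<open>
  The distance is a minimum over paths; bounding it by the length of any walk is what makes
  concatenation and reversal of walks usable below.
\<close>

lemma (in wf_digraph) graph_dist_le_awalk:
  assumes "awalk u p v"
  shows "graph_dist G u v \<le> length p"
proof -
  have "graph_dist G u v \<le> length (awalk_to_apath p)"
    unfolding graph_dist_def using apath_awalk_to_apath[OF assms] by (intro Least_le) blast
  with length_awalk_to_apath_le[OF assms] show ?thesis by simp
qed

lemma (in wf_digraph) shortest_apath:
  assumes "u \<rightarrow>\<^sup>* v"
  obtains p where "apath u p v" "length p = graph_dist G u v"
proof -
  have "\<exists>k p. apath u p v \<and> length p = k" using assms by (auto simp: reachable_apath)
  from LeastI_ex[OF this] show ?thesis using that unfolding graph_dist_def by blast
qed

lemma (in sym_digraph) awalk_reversed: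
  assumes "awalk u p v"
  shows "\<exists>q. awalk v q u \<and> length q = length p"
  using assms
proof (induction p arbitrary: u)
  case Nil
  thus ?case by (intro exI[of _ "[]"]) (auto simp: awalk_Nil_iff)
next
  case (Cons e p)
  hence e: "e \<in> arcs G" "u = tail G e" and p: "awalk (head G e) p v"
    by (auto simp: awalk_Cons_iff)
  obtain q where q: "awalk v q (head G e)" "length q = length p" using Cons.IH[OF p] by blast
  obtain e' where e': "e' \<in> arcs G" "tail G e' = head G e" "head G e' = tail G e"
    using sym_arcs e(1) unfolding symmetric_conv by metis
  have "awalk (head G e) [e'] u" using e e' by (auto simp: awalk_Cons_iff awalk_Nil_iff)
  from awalk_appendI[OF q(1) this] show ?case using q(2) by (intro exI[of _ "q @ [e']"]) simp
qed

lemma (in sym_digraph) graph_dist_commute: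
  assumes "u \<rightarrow>\<^sup>* v"
  shows "graph_dist G u v = graph_dist G v u"
proof -
  have le: "graph_dist G y x \<le> graph_dist G x y" if xy: "x \<rightarrow>\<^sup>* y" for x y
  proof -
    obtain p where p: "apath x p y" "length p = graph_dist G x y" using shortest_apath[OF xy] .
    obtain q where "awalk y q x" "length q = length p"
      using awalk_reversed[OF awalkI_apath[OF p(1)]] by blast
    thus ?thesis using graph_dist_le_awalk p(2) by metis
  qed
  have "v \<rightarrow>\<^sup>* u" using assms symmetric_reachable[OF sym_arcs] by blast
  thus ?thesis using le assms by (simp add: antisym)
qed

lemma (in wf_digraph) graph_dist_self:
  "v \<in> verts G \<Longrightarrow> graph_dist G v v = 0"
  using graph_dist_le_awalk[of v "[]" v] by (simp add: awalk_Nil_iff)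

lemma (in wf_digraph) graph_dist_ge_1:
  assumes "u \<rightarrow>\<^sup>* v" "u \<noteq> v"
  shows "graph_dist G u v \<ge> 1"
proof -
  obtain p where "apath u p v" "length p = graph_dist G u v" using shortest_apath[OF assms(1)] .
  thus ?thesis using assms(2) by (cases p) (auto simp: apath_Nil_iff)
qed

lemma (in wf_digraph) graph_dist_ge_2:
  assumes "u \<rightarrow>\<^sup>* v" "u \<noteq> v" "\<not> u \<rightarrow> v"
  shows "graph_dist G u v \<ge> 2"
proof (rule ccontr)
  assume "\<not> ?thesis"
  hence 1: "graph_dist G u v = 1" using graph_dist_ge_1[OF assms(1,2)] by simp
  obtain p where "apath u p v" "length p = graph_dist G u v" using shortest_apath[OF assms(1)] .
  then obtain e where "apath u [e] v" using 1 by (cases p) auto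
  hence "u \<rightarrow> v" by (auto simp: apath_simps intro: in_arcs_imp_in_arcs_ends)
  thus False using assms by simp
qed

lemma (in wf_digraph) graph_dist_adj_le:
  assumes "u \<rightarrow> w" "w \<rightarrow>\<^sup>* v"
  shows "graph_dist G u v \<le> graph_dist G w v + 1"
proof -
  obtain p where p: "apath w p v" "length p = graph_dist G w v" using shortest_apath[OF assms(2)] .
  obtain e where "e \<in> arcs G" "tail G e = u" "head G e = w" using assms(1) by auto
  hence "awalk u (e # p) v" using awalkI_apath[OF p(1)] by (simp add: awalk_Cons_iff)
  from graph_dist_le_awalk[OF this] p(2) show ?thesis by simp
qed

section \<open>A large independent set\<close>

text \<open>
  The largest colour class of an optimal colouring: if all \<open>\<chi>\<close> classes had fewer than
  \<open>n / \<chi>\<close> vertices, they could not cover the graph.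
\<close>

lemma (in digraph) large_independent_set:
  assumes "verts G \<noteq> {}"
  obtains C where "C \<subseteq> verts G" "C \<noteq> {}" "\<And>u v. u \<in> C \<Longrightarrow> v \<in> C \<Longrightarrow> \<not> u \<rightarrow> v"
    "card (verts G) \<le> chromatic_number G * card C"
proof -
  obtain f where "bij_betw f (verts G) {0..<card (verts G)}"
    using ex_bij_betw_finite_nat[OF finite_verts] by blast
  hence f: "inj_on f (verts G)" "f ` verts G = {0..<card (verts G)}" by (auto simp: bij_betw_def)
  have "proper_coloring G (card (verts G)) f"
    unfolding proper_coloring_def
  proof (intro conjI allI impI ballI)
    fix v assume "v \<in> verts G" thus "f v < card (verts G)" using f(2) by auto
  next
    fix u v assume "u \<rightarrow> v"
    with adj_not_same have "u \<noteq> v" by blast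
    with adj_in_verts[OF \<open>u \<rightarrow> v\<close>] show "f u \<noteq> f v"
      using f(1) by (auto dest: inj_onD)
  qed
  \<comment> \<open>The injective colouring shows that the minimum defining the chromatic number is attained.\<close>
  hence "\<exists>k c. proper_coloring G k c" by blast
  from LeastI_ex[OF this] obtain c where c: "proper_coloring G (chromatic_number G) c"
    unfolding chromatic_number_def by blast
  let ?\<chi> = "chromatic_number G" and ?n = "card (verts G)"
  define C where "C = (\<lambda>k. {v \<in> verts G. c v = k})"
  have less: "c v < ?\<chi>" if "v \<in> verts G" for v using c that by (simp add: proper_coloring_def)
  have "(\<Sum>k<?\<chi>. card (C k)) = card (\<Union>k<?\<chi>. C k)"
    by (rule card_UN_disjoint[symmetric]) (auto simp: C_def)
  also have "(\<Union>k<?\<chi>. C k) = verts G" using less by (auto simp: C_def)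
  finally have sum: "(\<Sum>k<?\<chi>. card (C k)) = ?n" .
  have "\<exists>k<?\<chi>. ?n \<le> ?\<chi> * card (C k)"
  proof (rule ccontr)
    assume "\<not> ?thesis"
    hence small: "?\<chi> * card (C k) < ?n" if "k < ?\<chi>" for k using that by force
    have "{..<?\<chi>} \<noteq> {}" using assms less by fastforce
    hence "(\<Sum>k<?\<chi>. ?\<chi> * card (C k)) < (\<Sum>k<?\<chi>. ?n)"
      using small by (intro sum_strict_mono) auto
    thus False by (simp add: sum_distrib_left[symmetric] sum)
  qed
  then obtain k where k: "k < ?\<chi>" "?n \<le> ?\<chi> * card (C k)" by blast
  show ?thesis
  proof (rule that[of "C k"])
    show "?n \<le> ?\<chi> * card (C k)" by fact
    moreover have "?n > 0" using assms by (simp add: card_gt_0_iff)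
    ultimately show "C k \<noteq> {}" by auto
    show "\<not> u \<rightarrow> v" if "u \<in> C k" "v \<in> C k" for u v
    proof
      assume "u \<rightarrow> v"
      hence "c u \<noteq> c v" using c by (simp add: proper_coloring_def)
      thus False using that by (simp add: C_def)
    qed
  qed (auto simp: C_def)
qed

section \<open>The distance Laplacian as a quadratic form\<close>

lemma sum_squared_differences:
  fixes x :: "'a \<Rightarrow> real"
  shows "(\<Sum>i\<in>C. \<Sum>j\<in>C. (x i - x j)\<^sup>2) = 2 * real (card C) * (\<Sum>i\<in>C. (x i)\<^sup>2) - 2 * (\<Sum>i\<in>C. x i)\<^sup>2"
proof -
  have "(\<Sum>i\<in>C. \<Sum>j\<in>C. (x i - x j)\<^sup>2)
      = (\<Sum>i\<in>C. \<Sum>j\<in>C. (x i)\<^sup>2) + (\<Sum>i\<in>C. \<Sum>j\<in>C. (x j)\<^sup>2) - 2 * (\<Sum>i\<in>C. \<Sum>j\<in>C. x i * x j)"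
    by (simp add: power2_diff sum.distrib sum_subtractf sum_distrib_left mult.assoc)
  also have "(\<Sum>i\<in>C. \<Sum>j\<in>C. x i * x j) = (\<Sum>i\<in>C. x i)\<^sup>2"
    by (simp add: power2_eq_square sum_product)
  also have "(\<Sum>i\<in>C. \<Sum>j\<in>C. (x i)\<^sup>2) = real (card C) * (\<Sum>i\<in>C. (x i)\<^sup>2)"
    by (simp add: sum_distrib_left)
  finally show ?thesis by simp
qed

text \<open>
  Weight 1 on every pair is the Laplacian of the complete graph, which acts as \<open>n\<close> on vectors
  of sum zero. What the weights exceed 1 by is nonnegative and may be discarded outside any set
  \<open>E\<close> of ordered pairs.
\<close>

lemma weighted_form_lower_bound:
  fixes d :: "nat \<Rightarrow> nat \<Rightarrow> real" and x :: "nat \<Rightarrow> real"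
  assumes d: "\<And>i j. i < n \<Longrightarrow> j < n \<Longrightarrow> i \<noteq> j \<Longrightarrow> d i j \<ge> 1"
    and x: "(\<Sum>i<n. x i) = 0" and E: "E \<subseteq> {..<n} \<times> {..<n}"
  shows "2 * real n * (\<Sum>i<n. (x i)\<^sup>2) + (\<Sum>(i,j)\<in>E. (d i j - 1) * (x i - x j)\<^sup>2)
    \<le> (\<Sum>i<n. \<Sum>j<n. d i j * (x i - x j)\<^sup>2)"
proof -
  have "(\<Sum>(i,j)\<in>E. (d i j - 1) * (x i - x j)\<^sup>2)
      \<le> (\<Sum>(i,j)\<in>{..<n} \<times> {..<n}. (d i j - 1) * (x i - x j)\<^sup>2)"
  proof (rule sum_mono2[OF _ E])
    fix ij assume "ij \<in> {..<n} \<times> {..<n} - E"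
    then obtain i j where ij: "ij = (i,j)" "i < n" "j < n" by auto
    show "0 \<le> (case ij of (i,j) \<Rightarrow> (d i j - 1) * (x i - x j)\<^sup>2)"
      using d[of i j] ij by (cases "i = j") auto
  qed simp
  also have "\<dots> = (\<Sum>i<n. \<Sum>j<n. d i j * (x i - x j)\<^sup>2) - (\<Sum>i<n. \<Sum>j<n. (x i - x j)\<^sup>2)"
    by (simp add: sum.cartesian_product[symmetric] sum_subtractf left_diff_distrib)
  also have "(\<Sum>i<n. \<Sum>j<n. (x i - x j)\<^sup>2) = 2 * real n * (\<Sum>i<n. (x i)\<^sup>2)"
    using x by (simp add: sum_squared_differences)
  finally show ?thesis by simp
qed

locale listed_connected_graph = graph +
  fixes vs :: "'a list"
  assumes connected: "Digraph_Component.connected G"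
    and distinct_vs: "distinct vs" and set_vs: "set vs = verts G"
begin

abbreviation n :: nat where "n \<equiv> length vs"

abbreviation d :: "nat \<Rightarrow> nat \<Rightarrow> real" where
  "d i j \<equiv> real (graph_dist G (vs ! i) (vs ! j))"

abbreviation DL :: "real mat" where "DL \<equiv> distance_laplacian G vs"

lemma reachable: "u \<in> verts G \<Longrightarrow> v \<in> verts G \<Longrightarrow> u \<rightarrow>\<^sup>* v"
  using symmetric_connected_imp_strongly_connected[OF sym_arcs connected]
  by (auto simp: strongly_connected_def)

lemma vs_in_verts: "i < n \<Longrightarrow> vs ! i \<in> verts G"
  using set_vs nth_mem by blast

lemma d_commute: "i < n \<Longrightarrow> j < n \<Longrightarrow> d i j = d j i"
  using graph_dist_commute[OF reachable] vs_in_verts by simp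

lemma d_ge_1: "i < n \<Longrightarrow> j < n \<Longrightarrow> i \<noteq> j \<Longrightarrow> d i j \<ge> 1"
  using graph_dist_ge_1[OF reachable, of "vs ! i" "vs ! j"] vs_in_verts distinct_vs
  by (simp add: nth_eq_iff_index_eq)

lemma DL_carrier: "DL \<in> carrier_mat n n"
  unfolding distance_laplacian_def distance_matrix_def by (intro minus_carrier_mat mat_carrier)

lemma DL_symmetric: "transpose_mat DL = DL"
  using d_commute by (intro eq_matI) (auto simp: distance_laplacian_def distance_matrix_def mat_diag_def)

lemma DL_mult_vec:
  assumes x: "x \<in> carrier_vec n" and i: "i < n"
  shows "(DL *\<^sub>v x) $ i = (\<Sum>j<n. d i j * (x $ i - x $ j))"
proof -
  have T: "real (transmission G (vs ! i)) = (\<Sum>j<n. d i j)"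
  proof -
    have "real (transmission G (vs ! i)) = (\<Sum>u\<in>set vs. real (graph_dist G u (vs ! i)))"
      unfolding transmission_def set_vs by simp
    also have "\<dots> = (\<Sum>j<n. d j i)"
      by (rule sum.reindex_bij_betw[OF bij_betw_nth[OF distinct_vs refl refl], symmetric])
    also have "\<dots> = (\<Sum>j<n. d i j)" using i by (intro sum.cong refl d_commute) auto
    finally show ?thesis .
  qed
  have "(DL *\<^sub>v x) $ i = (\<Sum>j<n. ((if i = j then real (transmission G (vs ! i)) else 0) - d i j) * x $ j)"
    using x i by (simp add: distance_laplacian_def distance_matrix_def mat_diag_def scalar_prod_def
        lessThan_atLeast0 cong: if_cong)
  also have "\<dots> = real (transmission G (vs ! i)) * x $ i - (\<Sum>j<n. d i j * x $ j)"
    using i by (simp add: left_diff_distrib sum_subtractf if_distrib[of "\<lambda>a. a * _"] cong: if_cong)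
  finally show ?thesis by (simp add: T right_diff_distrib sum_subtractf sum_distrib_right)
qed

lemma DL_form:
  assumes x: "x \<in> carrier_vec n"
  shows "2 * (x \<bullet> (DL *\<^sub>v x)) = (\<Sum>i<n. \<Sum>j<n. d i j * (x $ i - x $ j)\<^sup>2)"
proof -
  have form: "x \<bullet> (DL *\<^sub>v x) = (\<Sum>i<n. \<Sum>j<n. d i j * x $ i * (x $ i - x $ j))"
    using x DL_carrier DL_mult_vec[OF x]
    by (simp add: scalar_prod_def lessThan_atLeast0 sum_distrib_left ac_simps del: index_mult_mat_vec)
  also have "\<dots> = (\<Sum>j<n. \<Sum>i<n. d i j * x $ i * (x $ i - x $ j))" by (rule sum.swap)
  also have "\<dots> = (\<Sum>i<n. \<Sum>j<n. d i j * x $ j * (x $ j - x $ i))"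
    by (intro sum.cong refl) (simp add: d_commute)
  finally have "2 * (x \<bullet> (DL *\<^sub>v x)) = (\<Sum>i<n. \<Sum>j<n. d i j * x $ i * (x $ i - x $ j))
      + (\<Sum>i<n. \<Sum>j<n. d i j * x $ j * (x $ j - x $ i))" using form by simp
  thus ?thesis
    by (simp add: sum.distrib[symmetric] power2_eq_square algebra_simps)
qed

text \<open>
  Homogeneous equations for the vectors of sum zero that vanish outside \<open>I\<close>.
\<close>

definition support_constraints :: "nat set \<Rightarrow> real vec list" where
  "support_constraints I = vec n (\<lambda>_. 1) # map (unit_vec n) (filter (\<lambda>i. i \<notin> I) [0..<n])"

lemma support_constraints_carrier: "set (support_constraints I) \<subseteq> carrier_vec n"
  by (auto simp: support_constraints_def)

lemma length_support_constraints:
  assumes "I \<subseteq> {..<n}"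
  shows "length (support_constraints I) = Suc (n - card I)"
proof -
  have "{i. i < n \<and> i \<notin> I} = {..<n} - I" by auto
  thus ?thesis using assms
    by (simp add: support_constraints_def distinct_length_filter card_Diff_subset finite_subset Int_def conj_commute)
qed

lemma support_constraints_solution:
  assumes "x \<in> carrier_vec n" and "\<forall>\<rho>\<in>set (support_constraints I). \<rho> \<bullet> x = 0"
  shows "(\<Sum>i<n. x $ i) = 0" and "\<And>i. i < n \<Longrightarrow> i \<notin> I \<Longrightarrow> x $ i = 0"
  using assms by (auto simp: support_constraints_def scalar_prod_def[of "vec n _"] lessThan_atLeast0)

text \<open>
  The common frame of both bounds: vectors of sum zero supported on \<open>I\<close>, subject to further
  constraints \<open>R\<close>. The part of the form coming from distance 1 already contributes \<open>n\<close>, so only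
  the excess distances \<open>d - 1\<close> have to be estimated. The factor 2 appears because ordered pairs
  count each edge twice.
\<close>

lemma eigenvalue_count_by_form:
  assumes I: "I \<subseteq> {..<n}" and R: "set R \<subseteq> carrier_vec n" and E: "E \<subseteq> {..<n} \<times> {..<n}"
    and excess: "\<And>x. (\<Sum>i\<in>I. x $ i) = 0 \<Longrightarrow> x \<in> carrier_vec n \<Longrightarrow> \<forall>\<rho>\<in>set R. \<rho> \<bullet> x = 0 \<Longrightarrow>
      (\<Sum>(i,j)\<in>E. (d i j - 1) * (x $ i - x $ j)\<^sup>2) \<ge> 2 * s * (\<Sum>i\<in>I. (x $ i)\<^sup>2)"
  shows "card I \<le> Suc (length R) + size (filter_mset (\<lambda>e. e \<ge> real n + s) (eigenvalues_mset DL))"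
proof -
  have "n \<le> length (support_constraints I @ R)
      + size (filter_mset (\<lambda>e. e \<ge> real n + s) (eigenvalues_mset DL))"
  proof (rule eigenvalue_count_by_constraints[OF DL_carrier DL_symmetric])
    show "set (support_constraints I @ R) \<subseteq> carrier_vec n"
      using R support_constraints_carrier by simp
    fix x :: "real vec"
    assume x: "x \<in> carrier_vec n" and c: "\<forall>\<rho>\<in>set (support_constraints I @ R). \<rho> \<bullet> x = 0"
    have sum0: "(\<Sum>i<n. x $ i) = 0" and out: "\<And>i. i < n \<Longrightarrow> i \<notin> I \<Longrightarrow> x $ i = 0"
      using support_constraints_solution[OF x, of I] c by auto
    have "(\<Sum>i\<in>I. x $ i) = (\<Sum>i<n. x $ i)"
      using I out by (intro sum.mono_neutral_left) auto
    hence "2 * s * (\<Sum>i\<in>I. (x $ i)\<^sup>2) \<le> (\<Sum>(i,j)\<in>E. (d i j - 1) * (x $ i - x $ j)\<^sup>2)"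
      using excess[OF _ x] c sum0 by simp
    moreover have "(\<Sum>i\<in>I. (x $ i)\<^sup>2) = (\<Sum>i<n. (x $ i)\<^sup>2)"
      using I out by (intro sum.mono_neutral_left) auto
    moreover have "x \<bullet> x = (\<Sum>i<n. (x $ i)\<^sup>2)"
      using x by (simp add: scalar_prod_def lessThan_atLeast0 power2_eq_square)
    ultimately show "(real n + s) * (x \<bullet> x) \<le> x \<bullet> (DL *\<^sub>v x)"
      using weighted_form_lower_bound[of n d "\<lambda>i. x $ i", OF d_ge_1 sum0 E] DL_form[OF x]
      by (simp add: algebra_simps)
  qed
  moreover have "card I \<le> n" using card_mono[OF _ I] by simp
  ultimately show ?thesis using length_support_constraints[OF I] by simp
qed

section \<open>Two test subspaces\<close>

text \<open>
  Distinct vertices of \<open>C\<close> have distance at least 2, so on vectors of sum zero supported on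
  \<open>C\<close> the excess dominates the Laplacian of the complete graph on \<open>C\<close>, which acts there as
  \<open>card C\<close>. The subspace has dimension \<open>card C - 1\<close>.
\<close>

lemma eigenvalue_count_independent_set:
  assumes C: "C \<subseteq> verts G" and indep: "\<And>u v. u \<in> C \<Longrightarrow> v \<in> C \<Longrightarrow> \<not> u \<rightarrow> v"
  shows "card C \<le> Suc (size (filter_mset (\<lambda>e. e \<ge> real n + real (card C)) (eigenvalues_mset DL)))"
proof -
  define I where "I = {i. i < n \<and> vs ! i \<in> C}"
  have I: "I \<subseteq> {..<n}" by (auto simp: I_def)
  have "bij_betw (\<lambda>i. vs ! i) I C"
    unfolding bij_betw_def
  proof
    show "inj_on (\<lambda>i. vs ! i) I" using distinct_vs by (auto simp: I_def inj_on_def nth_eq_iff_index_eq)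
    have "C \<subseteq> (\<lambda>i. vs ! i) ` I"
    proof
      fix v assume v: "v \<in> C"
      hence "v \<in> set vs" using C set_vs by auto
      then obtain i where "i < n" "vs ! i = v" by (auto simp: in_set_conv_nth)
      thus "v \<in> (\<lambda>i. vs ! i) ` I" using v by (auto simp: I_def)
    qed
    thus "(\<lambda>i. vs ! i) ` I = C" by (auto simp: I_def)
  qed
  hence card: "card I = card C" by (rule bij_betw_same_card)
  have d2: "d i j \<ge> 2" if "i \<in> I" "j \<in> I" "i \<noteq> j" for i j
    using graph_dist_ge_2[OF reachable, of "vs ! i" "vs ! j"] that indep vs_in_verts distinct_vs
    by (simp add: I_def nth_eq_iff_index_eq)
  have "card I \<le> Suc (length ([] :: real vec list))
      + size (filter_mset (\<lambda>e. e \<ge> real n + real (card I)) (eigenvalues_mset DL))"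
  proof (rule eigenvalue_count_by_form[OF I, where E = "I \<times> I"])
    fix x :: "real vec" assume x: "(\<Sum>i\<in>I. x $ i) = 0"
    have "2 * real (card I) * (\<Sum>i\<in>I. (x $ i)\<^sup>2) = (\<Sum>i\<in>I. \<Sum>j\<in>I. (x $ i - x $ j)\<^sup>2)"
      using sum_squared_differences[of "\<lambda>i. x $ i" I] x by simp
    also have "\<dots> \<le> (\<Sum>i\<in>I. \<Sum>j\<in>I. (d i j - 1) * (x $ i - x $ j)\<^sup>2)"
    proof (intro sum_mono)
      fix i j assume "i \<in> I" "j \<in> I"
      thus "(x $ i - x $ j)\<^sup>2 \<le> (d i j - 1) * (x $ i - x $ j)\<^sup>2"
        using d2[of i j] mult_right_mono[of 1 "d i j - 1" "(x $ i - x $ j)\<^sup>2"] by (cases "i = j") auto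
    qed
    finally show "2 * real (card I) * (\<Sum>i\<in>I. (x $ i)\<^sup>2)
        \<le> (\<Sum>(i,j)\<in>I \<times> I. (d i j - 1) * (x $ i - x $ j)\<^sup>2)"
      by (simp add: sum.cartesian_product)
  qed (use I in auto)
  thus ?thesis by (simp add: card)
qed

text \<open>
  Any neighbours \<open>q\<close> of \<open>u\<close> and \<open>r\<close> of \<open>v\<close> will do: stepping to a neighbour
  lowers a distance by at most 1.
\<close>

lemma distance_3_quadruple:
  assumes u: "u \<in> verts G" and v: "v \<in> verts G" and uv: "graph_dist G u v \<ge> 3"
  obtains q r where "q \<in> verts G" "r \<in> verts G" "distinct [u, q, r, v]"
    "graph_dist G u r \<ge> 2" "graph_dist G q v \<ge> 2"
proof -
  have nbr: "\<exists>w. x \<rightarrow> w" if "x \<in> verts G" "y \<in> verts G" "x \<noteq> y" for x y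
  proof -
    have "\<exists>p. apath x p y" using reachable[of x y] that by (auto simp: reachable_apath)
    then obtain p where p: "apath x p y" ..
    with that(3) have "p \<noteq> []" by (auto simp: apath_Nil_iff)
    with p obtain e p' where "apath x (e # p') y" by (cases p) auto
    hence "x \<rightarrow> head G e" by (auto simp: apath_simps intro: in_arcs_imp_in_arcs_ends)
    thus ?thesis ..
  qed
  have neq: "u \<noteq> v" using uv graph_dist_self[OF u] by auto
  obtain q r where q: "u \<rightarrow> q" and r: "v \<rightarrow> r" using nbr u v neq by metis
  have qv: "q \<in> verts G" and rv: "r \<in> verts G" using adj_in_verts q r by auto
  have 1: "graph_dist G u v \<le> graph_dist G q v + 1" by (rule graph_dist_adj_le[OF q reachable[OF qv v]])
  have 2: "graph_dist G v u \<le> graph_dist G r u + 1" by (rule graph_dist_adj_le[OF r reachable[OF rv u]])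
  have comm: "graph_dist G x y = graph_dist G y x" if "x \<in> verts G" "y \<in> verts G" for x y
    using graph_dist_commute[OF reachable[OF that]] .
  have 3: "graph_dist G v r \<le> 1"
    using graph_dist_adj_le[OF r reachable[OF rv rv]] graph_dist_self[OF rv] by simp
  have ur: "graph_dist G u r \<ge> 2" using 2 uv comm[OF u v] comm[OF u rv] by simp
  have qv2: "graph_dist G q v \<ge> 2" using 1 uv by simp
  have "q \<noteq> r" using qv2 3 comm[OF v rv] by auto
  moreover have "u \<noteq> q" "v \<noteq> r" using adj_not_same q r by auto
  moreover have "q \<noteq> v" "u \<noteq> r" using qv2 ur graph_dist_self u v by force+
  ultimately show ?thesis using that[OF qv rv _ ur qv2] neq by auto
qed

text \<open>
  On a quadruple \<open>u, q, r, v\<close> as above, the excess distances dominate the Laplacian of the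
  path \<open>r, u, v, q\<close> with weights 1, 2, 1. Its eigenvalues are \<open>0\<close>, \<open>3 - sqrt 5\<close>, \<open>2\<close> and
  \<open>3 + sqrt 5\<close>, so exactly two of them reach 2. The vector \<open>(1, -1, -1, 1)\<close> along this
  path is an eigenvector for 2, and \<open>(0, 1, -1, 0)\<close> is a rational substitute for the top one.
  Among the vectors of sum zero on the quadruple, the plane they span is cut out by one further
  equation: equal values at \<open>q\<close> and \<open>r\<close>.
\<close>

lemma eigenvalue_count_diameter_3:
  assumes "graph_diam G \<ge> 3"
  shows "2 \<le> size (filter_mset (\<lambda>e. e \<ge> real n + 2) (eigenvalues_mset DL))"
proof -
  let ?D = "{graph_dist G u v | u v. u \<in> verts G \<and> v \<in> verts G}"
  have "?D = (\<lambda>(u,v). graph_dist G u v) ` (verts G \<times> verts G)" by auto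
  hence "finite ?D" by simp
  moreover have "?D \<noteq> {}" using connected unfolding connected_conv by fast
  ultimately have "graph_diam G \<in> ?D" unfolding graph_diam_def by (rule Max_in)
  then obtain u v where uv: "u \<in> verts G" "v \<in> verts G" "graph_dist G u v \<ge> 3" using assms by auto
  obtain q r where qr: "q \<in> verts G" "r \<in> verts G" "distinct [u, q, r, v]"
    "graph_dist G u r \<ge> 2" "graph_dist G q v \<ge> 2" using distance_3_quadruple[OF uv] .
  have "\<exists>i<n. vs ! i = w" if "w \<in> verts G" for w
    using that set_vs by (metis in_set_conv_nth)
  then obtain a b c e where idx: "a < n" "b < n" "c < n" "e < n"
      "vs ! a = u" "vs ! b = q" "vs ! c = r" "vs ! e = v" using uv qr by metis
  have dist: "distinct [a,b,c,e]" using qr(3) idx by auto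
  have dae: "d a e \<ge> 3" "d e a \<ge> 3" and dac: "d a c \<ge> 2" "d c a \<ge> 2" and dbe: "d b e \<ge> 2" "d e b \<ge> 2"
    using uv(3) qr(4,5) idx d_commute[of e a] d_commute[of c a] d_commute[of e b] by simp_all
  define I where "I = {a,b,c,e}"
  define \<rho> where "\<rho> = unit_vec n b - (unit_vec n c :: real vec)"
  define E where "E = {(a,e),(e,a),(a,c),(c,a),(b,e),(e,b)}"
  have I: "I \<subseteq> {..<n}" and cI: "card I = 4" using idx dist by (auto simp: I_def)
  have "card I \<le> Suc (length [\<rho>]) + size (filter_mset (\<lambda>e. e \<ge> real n + 2) (eigenvalues_mset DL))"
  proof (rule eigenvalue_count_by_form[OF I, where E = E])
    show "set [\<rho>] \<subseteq> carrier_vec n" by (simp add: \<rho>_def)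
    show "E \<subseteq> {..<n} \<times> {..<n}" using idx by (auto simp: E_def)
    fix x :: "real vec"
    assume s: "(\<Sum>i\<in>I. x $ i) = 0" and x: "x \<in> carrier_vec n" and r: "\<forall>\<rho>'\<in>set [\<rho>]. \<rho>' \<bullet> x = 0"
    have bc: "x $ b = x $ c"
      using r x idx by (simp add: \<rho>_def minus_scalar_prod_distrib[of _ n])
    have 0: "x $ a + x $ e = - 2 * x $ c" using s dist bc by (simp add: I_def)
    \<comment> \<open>The vector is \<open>(s, y - s, -y - s, s)\<close> along the path, where \<open>s\<close> is its value at
      the two path ends.\<close>
    define y where "y = x $ a + x $ c"
    have ae: "x $ a = y - x $ c" "x $ e = - y - x $ c" using 0 by (simp_all add: y_def)
    have "2 * 2 * (\<Sum>i\<in>I. (x $ i)\<^sup>2) = 4 * ((x $ a)\<^sup>2 + (x $ b)\<^sup>2 + (x $ c)\<^sup>2 + (x $ e)\<^sup>2)"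
      using dist by (simp add: I_def)
    also have "\<dots> \<le> 4 * (x $ a - x $ e)\<^sup>2 + 2 * (x $ a - x $ c)\<^sup>2 + 2 * (x $ b - x $ e)\<^sup>2"
      unfolding bc ae by (simp add: power2_eq_square algebra_simps)
    also have "\<dots> \<le> (d a e - 1) * (x $ a - x $ e)\<^sup>2 + (d e a - 1) * (x $ e - x $ a)\<^sup>2
        + (d a c - 1) * (x $ a - x $ c)\<^sup>2 + (d c a - 1) * (x $ c - x $ a)\<^sup>2
        + (d b e - 1) * (x $ b - x $ e)\<^sup>2 + (d e b - 1) * (x $ e - x $ b)\<^sup>2"
    proof -
      have m: "k * (t::real)\<^sup>2 \<le> (z - 1) * t\<^sup>2" if "z \<ge> k + 1" for k t z
        using that by (intro mult_right_mono) auto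
      show ?thesis
        using m[of 2 "d a e" "x $ a - x $ e"] m[of 2 "d e a" "x $ e - x $ a"]
          m[of 1 "d a c" "x $ a - x $ c"] m[of 1 "d c a" "x $ c - x $ a"]
          m[of 1 "d b e" "x $ b - x $ e"] m[of 1 "d e b" "x $ e - x $ b"] dae dac dbe
          power2_commute[of "x $ e" "x $ a"] power2_commute[of "x $ c" "x $ a"] power2_commute[of "x $ e" "x $ b"]
        by linarith
    qed
    also have "\<dots> = (\<Sum>(i,j)\<in>E. (d i j - 1) * (x $ i - x $ j)\<^sup>2)"
      using dist by (simp add: E_def)
    finally show "2 * 2 * (\<Sum>i\<in>I. (x $ i)\<^sup>2) \<le> (\<Sum>(i,j)\<in>E. (d i j - 1) * (x $ i - x $ j)\<^sup>2)" .
  qed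
  thus ?thesis by (simp add: cI)
qed

end

section \<open>Distance Laplacian eigenvalues and the chromatic number\<close>

theorem theorem5p4:
  fixes G :: "('a, 'b) pre_digraph" and vs :: "'a list"
    and n \<chi> :: nat and c :: int and b :: real
  assumes "graph G" and "Digraph_Component.connected G"
    and "distinct vs" and "set vs = verts G"
    and "n = card (verts G)" and "n \<ge> 5"
    and "\<chi> = chromatic_number G" and "\<chi> \<le> n - 1"
    and "c = \<lceil>real n / real \<chi>\<rceil>"
    and "b = real n + of_int c"
  shows "int (dL_count G vs {0..<b}) \<le> int n - c + 1 \<and>
         int (dL_count G vs {b..dL_eigenvalue G vs 1}) \<ge> c - 1 \<and>
         (graph_diam G \<ge> 3 \<longrightarrow>
           int (dL_count G vs {0..<b}) \<le> int n - max 2 (c - 1) \<and>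
           int (dL_count G vs {b..dL_eigenvalue G vs 1}) \<ge> max 2 (c - 1))"
proof -
  interpret graph G by fact
  interpret L: listed_connected_graph G vs by unfold_locales fact+
  have len: "length vs = n" using assms(3-5) by (metis distinct_card)
  define m where "m = (\<lambda>b. size (filter_mset (\<lambda>e. e \<ge> b) (eigenvalues_mset (distance_laplacian G vs))))"
  have m_mono: "m b \<le> m b'" if "b' \<le> b" for b b'
    unfolding m_def using that by (intro size_mset_mono filter_mset_mono_strong) auto
  have upper: "dL_count G vs {b..dL_eigenvalue G vs 1} = m b"
    by (simp only: m_def dL_count_from_below)
  have lower: "dL_count G vs {0..<b} + m b \<le> n"
    using dL_count_disjoint[of G vs 0 b] size_eigenvalues_mset_symmetric[OF L.DL_carrier L.DL_symmetric]
    by (simp add: m_def len)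
  have "verts G \<noteq> {}" using assms(5,6) by auto
  then obtain C where C: "C \<subseteq> verts G" "C \<noteq> {}" "\<And>u v. u \<in> C \<Longrightarrow> v \<in> C \<Longrightarrow> \<not> u \<rightarrow>\<^bsub>G\<^esub> v"
    and nC: "n \<le> \<chi> * card C"
    using large_independent_set assms(5,7) by metis
  have \<chi>: "\<chi> > 0" using nC assms(6) by (cases \<chi>) auto
  have "real n \<le> real \<chi> * real (card C)" using nC by (metis of_nat_le_iff of_nat_mult)
  hence cC: "c \<le> int (card C)"
    unfolding assms(9) using \<chi> by (simp add: ceiling_le_iff divide_le_eq mult.commute)
  \<comment> \<open>If \<open>c\<close> exceeds 2, the maximum in the second part is \<open>c - 1\<close>; hence only \<open>c = 2\<close>
    needs the assumption on the diameter.\<close>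
  have "real n / real \<chi> > 1" using \<chi> assms(6,8) by (simp add: less_divide_eq)
  hence c2: "c \<ge> 2" unfolding assms(9) by linarith
  have "card C \<le> Suc (m (real n + real (card C)))"
    using L.eigenvalue_count_independent_set[OF C(1,3)] by (simp add: m_def len)
  moreover have "m (real n + real (card C)) \<le> m b"
    using cC unfolding assms(10) by (intro m_mono) linarith
  ultimately have a: "int (m b) \<ge> c - 1" using cC by linarith
  have "int (m b) \<ge> max 2 (c - 1)" if diam: "graph_diam G \<ge> 3"
  proof (cases "c = 2")
    case True
    thus ?thesis using L.eigenvalue_count_diameter_3[OF diam] unfolding assms(10)
      by (simp add: m_def len)
  next
    case False
    thus ?thesis using a c2 by simp
  qed
  thus ?thesis using a lower unfolding upper by auto
qed

end
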